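(* Every finite tournament $T$ admits a colouring $c:V(T)\to\{1,2,3\}$ such that all but at most $205$ vertices $v$ of $T$ satisfy: the number of out-neighbours $w$ of $v$ with $c(w)=c(v)$ is at most $d^{+}(v)/2$, where $d^{+}(v)$ denotes the out-degree of $v$.
   Context: A tournament is a digraph in which for every pair of distinct vertices $u,v$ exactly one of the arcs $uv$, $vu$ is present. *)

theory Defs
  imports Complex_Main "Graph_Theory.Digraph"
begin

text \<open>Finiteness is not part of the locale (unlike \<^locale>\<open>digraph\<close>).
  Since \<^term>\<open>arcs_ends G\<close> is a set of pairs, parallel arcs have to be excluded
  separately, which \<^locale>\<open>nomulti_digraph\<close> does.\<close>

locale tournament = loopfree_digraph + nomulti_digraph +
  assumes exactly_one_arc:
    "\<lbrakk>u \<in> verts G; v \<in> verts G; u \<noteq> v\<rbrakk> \<Longrightarrow>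
      (u \<rightarrow>\<^bsub>G\<^esub> v \<and> \<not> v \<rightarrow>\<^bsub>G\<^esub> u) \<or> (v \<rightarrow>\<^bsub>G\<^esub> u \<and> \<not> u \<rightarrow>\<^bsub>G\<^esub> v)"

definition out_neighbours :: "('a, 'b) pre_digraph \<Rightarrow> 'a \<Rightarrow> 'a set" where
  "out_neighbours G v = {w \<in> verts G. v \<rightarrow>\<^bsub>G\<^esub> w}"

lemma (in nomulti_digraph) out_degree_eq_card_out_neighbours:
  "out_degree G v = card (out_neighbours G v)"
proof -
  have "out_neighbours G v = head G ` out_arcs G v"
    by (auto simp: out_neighbours_def arcs_ends_conv)
  moreover have "inj_on (head G) (out_arcs G v)"
    by (auto intro!: inj_onI no_multi_arcs simp: arc_to_ends_def)
  ultimately show ?thesis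
    by (simp add: out_degree_def card_image)
qed

lemma (in tournament) digraph_if_finite:
  assumes "finite (verts G)"
  shows "digraph G"
proof -
  have "arcs_ends G \<subseteq> verts G \<times> verts G"
    by (auto simp: arcs_ends_conv)
  then have "finite (arc_to_ends G ` arcs G)"
    using assms finite_subset unfolding arcs_ends_def by blast
  then have "finite (arcs G)"
    using inj_on_arc_to_ends finite_imageD by blast
  with assms show ?thesis
    by unfold_locales
qed

end

theory Submission
  imports Defs "HOL-Library.FuncSet"
begin

text \<open>Colour the vertices uniformly at random. For a vertex \<open>v\<close> of out-degree \<open>d\<close>, let \<open>X\<close> be the
  number of out-neighbours sharing its colour; the expectation of \<open>2 ^ X\<close> is \<open>(4/3) ^ d\<close>. If \<open>v\<close> is
  bad, then \<open>2 ^ X \<ge> 2 powr (d/2) \<ge> (7/5) ^ d\<close>, so by Markov's inequality \<open>v\<close> is bad with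
  probability at most \<open>(20/21) ^ d\<close>. Every \<open>k\<close> vertices of a tournament include one of out-degree at
  least \<open>(k-1)/2\<close>, hence the expected number of bad vertices is bounded by a geometric series with
  ratio \<open>sqrt (20/21) \<le> 49/50\<close>, whose sum is at most \<open>50\<close>.\<close>

text \<open>Once the colour of \<open>v\<close> is fixed, the summand is a product of factors each
  depending on one vertex only, so the sum over colourings factorises: \<open>v\<close> contributes
  1, a vertex of \<open>N\<close> contributes \<open>card C + 1\<close>, any other
  \<open>card C\<close>.\<close>

lemma sum_colourings_two_power_same_colour:
  fixes V N :: "'a set" and C :: "'c set"
  assumes V: "finite V" "v \<in> V" and N: "N \<subseteq> V - {v}" and C: "finite C" "C \<noteq> {}"
  shows "(\<Sum>f\<in>V \<rightarrow>\<^sub>E C. 2 ^ card {w \<in> N. f w = f v} :: real) =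
    real (card C) ^ card V * ((real (card C) + 1) / real (card C)) ^ card N"
proof -
  define q where "q = real (card C)"
  have q: "q > 0"
    using C by (simp add: q_def card_gt_0_iff)
  \<comment> \<open>The factor at \<open>v\<close> is the indicator that \<open>v\<close> has colour
    \<open>a\<close>, so summing the products over \<open>a\<close> leaves only the term
    \<open>a = f v\<close>.\<close>
  define g :: "'c \<Rightarrow> 'a \<Rightarrow> 'c \<Rightarrow> real" where
    "g a w x = (if w = v then of_bool (x = a) else if w \<in> N then 1 + of_bool (x = a) else 1)"
    for a w x
  have split: "2 ^ card {w \<in> N. f w = f v} = (\<Sum>a\<in>C. \<Prod>w\<in>V. g a w (f w))"
    if f: "f \<in> V \<rightarrow>\<^sub>E C" for f
  proof -
    have "(\<Prod>w\<in>V. g a w (f w)) = (if a = f v then 2 ^ card {w \<in> N. f w = f v} else 0)" for a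
    proof (cases "a = f v")
      case True
      have "(\<Prod>w\<in>V. g a w (f w)) = (\<Prod>w\<in>V. if w \<in> {w \<in> N. f w = f v} then 2 else 1)"
        using N True by (intro prod.cong) (auto simp: g_def)
      also have "\<dots> = (\<Prod>w\<in>V \<inter> {w \<in> N. f w = f v}. 2)"
        by (rule prod.inter_restrict [symmetric]) fact
      also have "V \<inter> {w \<in> N. f w = f v} = {w \<in> N. f w = f v}"
        using N by auto
      finally show ?thesis
        using True by simp
    next
      case False
      then have "g a v (f v) = 0"
        by (auto simp: g_def)
      with V False show ?thesis
        by (auto intro: prod_zero)
    qed
    moreover have "f v \<in> C"
      using f V by auto
    ultimately show ?thesis
      using C by (simp add: sum.delta)
  qed
  \<comment> \<open>Pulling \<open>q\<close> out of every vertex yields \<open>q ^ card V\<close>;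
    the remaining \<open>1 / q\<close> at \<open>v\<close> later cancels against the
    \<open>q\<close> choices of \<open>a\<close>.\<close>
  have factor: "(\<Sum>x\<in>C. g a w x) =
      q * ((if w = v then 1 / q else 1) * (if w \<in> N then (q + 1) / q else 1))"
    if "a \<in> C" for a w
    using that N C q by (auto simp: g_def q_def sum.distrib of_bool_def sum.delta)
  have "(\<Sum>f\<in>V \<rightarrow>\<^sub>E C. 2 ^ card {w \<in> N. f w = f v} :: real) =
      (\<Sum>f\<in>V \<rightarrow>\<^sub>E C. \<Sum>a\<in>C. \<Prod>w\<in>V. g a w (f w))"
    by (rule sum.cong) (simp_all add: split)
  also have "\<dots> = (\<Sum>a\<in>C. \<Sum>f\<in>V \<rightarrow>\<^sub>E C. \<Prod>w\<in>V. g a w (f w))"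
    by (rule sum.swap)
  also have "\<dots> = (\<Sum>a\<in>C. \<Prod>w\<in>V. \<Sum>x\<in>C. g a w x)"
    using V C by (simp add: prod_sum_PiE)
  also have "\<dots> = (\<Sum>a\<in>C. \<Prod>w\<in>V.
      q * ((if w = v then 1 / q else 1) * (if w \<in> N then (q + 1) / q else 1)))"
    by (simp add: factor)
  also have "(\<Prod>w\<in>V. q * ((if w = v then 1 / q else 1) * (if w \<in> N then (q + 1) / q else 1))) =
      q ^ card V * (1 / q * (\<Prod>w\<in>V. if w \<in> N then (q + 1) / q else 1))"
    using V by (simp only: prod.distrib prod_constant prod.delta if_True)
  also have "(\<Prod>w\<in>V. if w \<in> N then (q + 1) / q else 1) = ((q + 1) / q) ^ card (V \<inter> N)"
    using V by (simp add: prod.inter_restrict [symmetric])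
  also have "V \<inter> N = N"
    using N by auto
  finally show ?thesis
    using q by (simp add: q_def)
qed

context tournament
begin

text \<open>Adding the arc count to its transpose counts every ordered pair of distinct vertices of
  \<open>S\<close> exactly once.\<close>

lemma sum_card_out_neighbours_in:
  assumes "finite S" "S \<subseteq> verts G"
  shows "2 * (\<Sum>v\<in>S. card {w \<in> S. v \<rightarrow>\<^bsub>G\<^esub> w}) = card S * (card S - 1)"
proof -
  have count: "card {w \<in> S. P w} = (\<Sum>w\<in>S. of_bool (P w))" for P
    using assms by (simp add: Int_def)
  have one: "of_bool (v \<rightarrow>\<^bsub>G\<^esub> w) + of_bool (w \<rightarrow>\<^bsub>G\<^esub> v) = (of_bool (w \<noteq> v) :: nat)"
    if "v \<in> S" "w \<in> S" for v w
    using that assms exactly_one_arc [of v w] adj_not_same by auto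
  have swap: "(\<Sum>v\<in>S. \<Sum>w\<in>S. of_bool (v \<rightarrow>\<^bsub>G\<^esub> w) :: nat) =
      (\<Sum>v\<in>S. \<Sum>w\<in>S. of_bool (w \<rightarrow>\<^bsub>G\<^esub> v))"
    by (rule sum.swap)
  have "2 * (\<Sum>v\<in>S. card {w \<in> S. v \<rightarrow>\<^bsub>G\<^esub> w}) =
      (\<Sum>v\<in>S. \<Sum>w\<in>S. of_bool (v \<rightarrow>\<^bsub>G\<^esub> w)) + (\<Sum>v\<in>S. \<Sum>w\<in>S. of_bool (w \<rightarrow>\<^bsub>G\<^esub> v))"
    by (simp only: count mult_2 swap [symmetric])
  also have "\<dots> = (\<Sum>v\<in>S. \<Sum>w\<in>S. of_bool (w \<noteq> v))"
    unfolding sum.distrib [symmetric] by (intro sum.cong refl one)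
  also have "\<dots> = (\<Sum>v\<in>S. card (S - {v}))"
    by (intro sum.cong refl) (simp add: count [symmetric] set_diff_eq)
  also have "\<dots> = card S * (card S - 1)"
    using assms by simp
  finally show ?thesis .
qed

text \<open>The average out-degree inside \<open>S\<close> is \<open>(card S - 1) / 2\<close>, and
  leaving \<open>S\<close> can only add out-neighbours.\<close>

lemma large_out_degree_vertex:
  assumes fin: "finite (verts G)" and S: "S \<subseteq> verts G" "S \<noteq> {}"
  obtains v where "v \<in> S" "card S \<le> 2 * card (out_neighbours G v) + 1"
proof -
  have finS: "finite S"
    using fin S finite_subset by blast
  have "\<exists>v\<in>S. card S - 1 \<le> 2 * card {w \<in> S. v \<rightarrow>\<^bsub>G\<^esub> w}"
  proof (rule ccontr)
    assume "\<not> ?thesis"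
    then have "(\<Sum>v\<in>S. 2 * card {w \<in> S. v \<rightarrow>\<^bsub>G\<^esub> w}) < (\<Sum>v\<in>S. card S - 1)"
      using finS S by (intro sum_strict_mono) (auto simp: not_le)
    then show False
      using sum_card_out_neighbours_in [OF finS S(1)] by (simp add: sum_distrib_left)
  qed
  then obtain v where v: "v \<in> S" "card S - 1 \<le> 2 * card {w \<in> S. v \<rightarrow>\<^bsub>G\<^esub> w}"
    by blast
  moreover have "card {w \<in> S. v \<rightarrow>\<^bsub>G\<^esub> w} \<le> card (out_neighbours G v)"
    using fin S by (intro card_mono) (auto simp: out_neighbours_def)
  ultimately show thesis
    using that [of v] by simp
qed

text \<open>Vertices are removed greedily: among \<open>n + 1\<close> remaining ones, some vertex
  has twice its out-degree at least \<open>n\<close> and costs at most \<open>q ^ n\<close>. Degrees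
  are taken in the whole tournament, so removal does not change them. The doubled exponent avoids
  square roots.\<close>

lemma sum_power_out_degree_le:
  fixes q :: real
  assumes fin: "finite (verts G)" and "S \<subseteq> verts G" and q: "0 \<le> q" "q \<le> 1"
  shows "(\<Sum>v\<in>S. q ^ (2 * card (out_neighbours G v))) \<le> (\<Sum>i<card S. q ^ i)"
  using \<open>S \<subseteq> verts G\<close>
proof (induction "card S" arbitrary: S)
  case 0
  then have "S = {}"
    using fin finite_subset by fastforce
  then show ?case
    by simp
next
  case (Suc n)
  have finS: "finite S"
    using fin Suc.prems finite_subset by blast
  have "S \<noteq> {}"
    using Suc.hyps(2) by auto
  then obtain v where v: "v \<in> S" "card S \<le> 2 * card (out_neighbours G v) + 1"
    using large_out_degree_vertex [OF fin Suc.prems] by blast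
  have n: "n = card (S - {v})"
    using Suc.hyps(2) v finS by simp
  have "(\<Sum>v\<in>S - {v}. q ^ (2 * card (out_neighbours G v))) \<le> (\<Sum>i<n. q ^ i)"
    using Suc.hyps(1) [OF n] Suc.prems n by auto
  moreover have "q ^ (2 * card (out_neighbours G v)) \<le> q ^ n"
    using v Suc.hyps(2) q by (intro power_decreasing) auto
  ultimately show ?case
    using finS v Suc.hyps(2) [symmetric] by (simp add: sum.remove)
qed

end

text \<open>Compare squares: \<open>49 / 25\<close> is below 2 and \<open>d < 2 * m\<close>. Thus
  \<open>7 / 5\<close> serves as a rational lower bound for the square root of 2.\<close>

lemma majority_failure_two_power_ge:
  assumes "\<not> real m \<le> real d / 2"
  shows "(7 / 5) ^ d \<le> (2 :: real) ^ m"
proof -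
  have "((7 / 5 :: real) ^ d)\<^sup>2 = (49 / 25) ^ d"
    by (simp add: power_mult [symmetric] mult.commute [of d] power_divide) (simp add: power_mult)
  also have "\<dots> \<le> 2 ^ d"
    by (rule power_mono) auto
  also have "\<dots> \<le> 2 ^ (2 * m)"
    using assms by (intro power_increasing) auto
  also have "\<dots> = (2 ^ m)\<^sup>2"
    by (simp add: power_mult [symmetric] mult.commute)
  finally show ?thesis
    by (rule power2_le_imp_le) simp
qed

theorem theorem2:
  fixes T :: "('a, 'b) pre_digraph"
  assumes "tournament T" and "finite (verts T)"
  shows "\<exists>c :: 'a \<Rightarrow> nat. (\<forall>v \<in> verts T. c v \<in> {1, 2, 3}) \<and>
    card {v \<in> verts T.
      \<not> real (card {w \<in> out_neighbours T v. c w = c v}) \<le> real (out_degree T v) / 2} \<le> 205"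
proof -
  interpret tournament T by fact
  define V where "V = verts T"
  define N where "N = out_neighbours T"
  \<comment> \<open>Extensionality outside \<open>V\<close> makes the set of colourings finite, so
    that averages over it make sense.\<close>
  define F where "F = (V \<rightarrow>\<^sub>E {1, 2, 3 :: nat})"
  define bad where "bad f = {v \<in> V. \<not> real (card {w \<in> N v. f w = f v}) \<le> real (card (N v)) / 2}"
    for f :: "'a \<Rightarrow> nat"
  have V: "finite V"
    using assms by (simp add: V_def)
  have F: "finite F" "F \<noteq> {}" "card F = 3 ^ card V"
    using V by (auto simp: F_def finite_PiE PiE_eq_empty_iff card_PiE numeral_3_eq_3)
  have N: "N v \<subseteq> V - {v}" for v
    using adj_not_same by (auto simp: N_def V_def out_neighbours_def)
  have "(\<Sum>f\<in>F. real (card (bad f))) \<le>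
      (\<Sum>f\<in>F. \<Sum>v\<in>V. 2 ^ card {w \<in> N v. f w = f v} / (7 / 5) ^ card (N v))"
  \<comment> \<open>Markov's inequality in counting form: each bad vertex has a term at least 1, and
    all other terms are nonnegative.\<close>
  proof (rule sum_mono)
    fix f
    have "real (card (bad f)) = (\<Sum>v\<in>bad f. 1)"
      by simp
    also have "\<dots> \<le> (\<Sum>v\<in>bad f. 2 ^ card {w \<in> N v. f w = f v} / (7 / 5) ^ card (N v))"
      by (rule sum_mono) (simp add: bad_def majority_failure_two_power_ge)
    also have "\<dots> \<le> (\<Sum>v\<in>V. 2 ^ card {w \<in> N v. f w = f v} / (7 / 5) ^ card (N v))"
      using V by (intro sum_mono2) (auto simp: bad_def)
    finally show "real (card (bad f)) \<le> \<dots>" .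
  qed
  also have "\<dots> = (\<Sum>v\<in>V. (\<Sum>f\<in>F. 2 ^ card {w \<in> N v. f w = f v}) / (7 / 5) ^ card (N v))"
    unfolding sum_divide_distrib by (rule sum.swap)
  also have "\<dots> = (\<Sum>v\<in>V. 3 ^ card V * (20 / 21) ^ card (N v))"
  proof (rule sum.cong [OF refl])
    fix v assume "v \<in> V"
    then have "(\<Sum>f\<in>F. 2 ^ card {w \<in> N v. f w = f v} :: real) = 3 ^ card V * (4 / 3) ^ card (N v)"
      using sum_colourings_two_power_same_colour [OF V _ N, of v "{1, 2, 3 :: nat}"]
      by (simp add: F_def)
    moreover have "(4 / 3 :: real) ^ k / (7 / 5) ^ k = (20 / 21) ^ k" for k
      by (subst power_divide [symmetric]) simp
    ultimately show "(\<Sum>f\<in>F. 2 ^ card {w \<in> N v. f w = f v}) / (7 / 5) ^ card (N v) =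
        (3 ^ card V * (20 / 21) ^ card (N v) :: real)"
      by (simp only: times_divide_eq_right [symmetric])
  qed
  \<comment> \<open>Here \<open>20 / 21\<close> is at most
    \<open>(49 / 50)\<^sup>2 = 0.9604\<close>.\<close>
  also have "\<dots> \<le> (\<Sum>v\<in>V. 3 ^ card V * (49 / 50) ^ (2 * card (N v)))"
    unfolding power_mult by (intro sum_mono mult_left_mono power_mono) (auto simp: power2_eq_square)
  also have "\<dots> = 3 ^ card V * (\<Sum>v\<in>V. (49 / 50) ^ (2 * card (N v)))"
    by (simp only: sum_distrib_left)
  also have "\<dots> \<le> 3 ^ card V * (\<Sum>i<card V. (49 / 50) ^ i)"
    using sum_power_out_degree_le [of V "49 / 50"] assms by (intro mult_left_mono) (auto simp: V_def N_def)
  \<comment> \<open>The full geometric series sums to \<open>1 / (1 - 49 / 50) = 50\<close>.\<close>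
  also have "\<dots> \<le> 3 ^ card V * 50"
    by (intro mult_left_mono) (simp_all add: sum_gp_strict)
  also have "\<dots> = (\<Sum>f\<in>F. 50)"
    using F by simp
  \<comment> \<open>If every colouring had more than 50 bad vertices, the total over the nonempty
    set \<open>F\<close> would exceed \<open>50 * card F\<close>.\<close>
  finally have "\<exists>f\<in>F. real (card (bad f)) \<le> 50"
    using sum_strict_mono [OF F(1,2), of "\<lambda>_. 50" "\<lambda>f. real (card (bad f))"] by (meson not_le)
  then obtain f where f: "f \<in> F" "card (bad f) \<le> 50"
    by auto
  have "\<forall>v\<in>verts T. f v \<in> {1, 2, 3}"
    using f by (auto simp: F_def V_def)
  moreover have "card (bad f) \<le> 205"
    using f by simp
  ultimately show ?thesis
    unfolding bad_def V_def N_def out_degree_eq_card_out_neighbours by blast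
qed

end
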